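(* Let $(V_i)_{i\ge1}$ and $(E_i)_{i\ge1}$ be independent i.i.d. sequences of copies of arbitrary continuous positive random variables $V$ and $E$, respectively, and for $k\ge1$ define $$\widehat D_k=1+\sum_{i=1}^{k}\mathbf 1_{\{V_i-E_i>\xi_k\}},\qquad \xi_k=\min_{1\le i\le k}(V_i+E_i).$$ If $\mathbb P(V<x)>0$ and $\mathbb P(E<x)>0$ for each $x>0$, then, with $V,E$ independent, $p=\mathbb P(V>E)$ satisfies $0<p<1$ and, as $k\to\infty$, $$\widehat D_k=p\cdot k\cdot(1+o_{\mathbb P}(1)).$$
   Context: "Continuous" means having a continuous (atomless) distribution. $o_{\mathbb P}(1)$ denotes a quantity converging to $0$ in probability as $k\to\infty$. *)

theory Defs
  imports "HOL-Probability.Probability"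
begin

definition continuous_rv :: "'a measure \<Rightarrow> ('a \<Rightarrow> real) \<Rightarrow> bool" where
  "continuous_rv N X \<longleftrightarrow>
     X \<in> borel_measurable N \<and> (\<forall>x. measure N {\<omega> \<in> space N. X \<omega> = x} = 0)"

text \<open>Sequences are indexed by the integers \<open>i \<ge> 1\<close>; the value at \<open>i = 0\<close> is unconstrained.
  The reference variable \<open>X\<close> may live on a different probability space.\<close>

definition iid_copies ::
    "'b measure \<Rightarrow> (nat \<Rightarrow> 'b \<Rightarrow> real) \<Rightarrow> 'a measure \<Rightarrow> ('a \<Rightarrow> real) \<Rightarrow> bool" where
  "iid_copies M Xs N X \<longleftrightarrow>
     prob_space.indep_vars M (\<lambda>_. borel) Xs {1..} \<and>
     (\<forall>i\<ge>1. distr M borel (Xs i) = distr N borel X)"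

text \<open>Independence of two whole sequences, viewed as random elements of the
  product space of real sequences indexed by \<open>{1..}\<close>.\<close>

definition indep_seqs ::
    "'b measure \<Rightarrow> (nat \<Rightarrow> 'b \<Rightarrow> real) \<Rightarrow> (nat \<Rightarrow> 'b \<Rightarrow> real) \<Rightarrow> bool" where
  "indep_seqs M Xs Ys \<longleftrightarrow>
     prob_space.indep_var M
       (PiM {1..} (\<lambda>_. borel)) (\<lambda>\<omega>. \<lambda>i\<in>{1..}. Xs i \<omega>)
       (PiM {1..} (\<lambda>_. borel)) (\<lambda>\<omega>. \<lambda>i\<in>{1..}. Ys i \<omega>)"

definition xi :: "(nat \<Rightarrow> 'b \<Rightarrow> real) \<Rightarrow> (nat \<Rightarrow> 'b \<Rightarrow> real) \<Rightarrow> nat \<Rightarrow> 'b \<Rightarrow> real" where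
  "xi Vs Es k \<omega> = Min ((\<lambda>i. Vs i \<omega> + Es i \<omega>) ` {1..k})"

definition D_hat :: "(nat \<Rightarrow> 'b \<Rightarrow> real) \<Rightarrow> (nat \<Rightarrow> 'b \<Rightarrow> real) \<Rightarrow> nat \<Rightarrow> 'b \<Rightarrow> real" where
  "D_hat Vs Es k \<omega> = 1 + (\<Sum>i=1..k. of_bool (Vs i \<omega> - Es i \<omega> > xi Vs Es k \<omega>))"

text \<open>The class \<open>o\<^sub>P(1)\<close> of sequences of random variables converging to \<open>0\<close> in probability.\<close>

definition little_o_P :: "'b measure \<Rightarrow> (nat \<Rightarrow> 'b \<Rightarrow> real) set" where
  "little_o_P M = {R. (\<forall>k. R k \<in> borel_measurable M) \<and>
     (\<forall>\<epsilon>>0. (\<lambda>k. measure M {\<omega> \<in> space M. \<bar>R k \<omega>\<bar> > \<epsilon>}) \<longlonglongrightarrow> 0)}"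

end

theory Submission
  imports Defs
begin

text \<open>Almost surely \<open>\<xi>\<^sub>k \<ge> 0\<close>, so \<open>D\<^sub>k - 1\<close> is at most the number of \<open>i \<le> k\<close> with
  \<open>V\<^sub>i - E\<^sub>i > 0\<close>; and \<open>\<xi>\<^sub>k \<rightarrow> 0\<close> in probability because \<open>V + E\<close> charges every
  neighbourhood of \<open>0\<close>, so for any \<open>t > 0\<close> it is, with high probability, at least the number with
  \<open>V\<^sub>i - E\<^sub>i > t\<close>. Both counts obey the weak law of large numbers, with means
  \<open>P(V - E > 0) = p\<close> and \<open>P(V - E > t)\<close>, and the latter tends to \<open>p\<close> as \<open>t \<down> 0\<close>.\<close>

section \<open>Independence of the sequence of pairs\<close>

text \<open>On preimages of measurable rectangles the probability factors twice: across the two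
  families by \<open>XY\<close>, then over the indices within each family. Rectangles are closed
  under intersection and generate the product sigma-algebra, so this suffices. It lets sums and
  differences of the paired variables be treated as functions of one independent sequence.\<close>

lemma (in prob_space) indep_vars_Pair:
  assumes X: "indep_vars S X I" and Y: "indep_vars T Y I"
    and XY: "indep_var (PiM I S) (\<lambda>\<omega>. \<lambda>i\<in>I. X i \<omega>) (PiM I T) (\<lambda>\<omega>. \<lambda>i\<in>I. Y i \<omega>)"
  shows "indep_vars (\<lambda>i. S i \<Otimes>\<^sub>M T i) (\<lambda>i \<omega>. (X i \<omega>, Y i \<omega>)) I"
proof -
  define P where "P = (\<lambda>i \<omega>. (X i \<omega>, Y i \<omega>))"
  define R where
    "R i = {P i -` C \<inter> space M | C. C \<in> {a \<times> b |a b. a \<in> sets (S i) \<and> b \<in> sets (T i)}}" for i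
  have rvX: "X i \<in> measurable M (S i)" and rvY: "Y i \<in> measurable M (T i)" if "i \<in> I" for i
    using X Y that by (auto simp: indep_vars_def)
  have rvP: "P i \<in> measurable M (S i \<Otimes>\<^sub>M T i)" if "i \<in> I" for i
    unfolding P_def using rvX rvY that by (intro measurable_Pair)
  have split: "prob (\<Inter>i\<in>J. P i -` (A i \<times> B i) \<inter> space M) =
      (\<Prod>i\<in>J. prob (X i -` A i \<inter> space M)) * (\<Prod>i\<in>J. prob (Y i -` B i \<inter> space M))"
    if J: "J \<noteq> {}" "finite J" "J \<subseteq> I"
      and AB: "\<And>i. i \<in> J \<Longrightarrow> A i \<in> sets (S i)" "\<And>i. i \<in> J \<Longrightarrow> B i \<in> sets (T i)" for J A B
  proof -
    \<comment> \<open>Cylinders that constrain only the coordinates in \<open>J\<close>: they turn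
      an event about finitely many indices into one about the whole sequence, to which
      \<open>XY\<close> applies.\<close>
    let ?A = "prod_emb I S J (Pi\<^sub>E J A)" and ?B = "prod_emb I T J (Pi\<^sub>E J B)"
    have emb: "(\<lambda>\<omega>. \<lambda>i\<in>I. Z i \<omega>) -` prod_emb I U J (Pi\<^sub>E J C) \<inter> space M
        = (\<Inter>i\<in>J. Z i -` C i \<inter> space M)"
      if "\<And>i. i \<in> I \<Longrightarrow> Z i \<in> measurable M (U i)" for Z :: "_ \<Rightarrow> _ \<Rightarrow> 'z" and U C
      using J that[THEN measurable_space]
      by (auto simp: prod_emb_def space_PiM PiE_iff extensional_def restrict_def subset_iff)
    have "(\<Inter>i\<in>J. P i -` (A i \<times> B i) \<inter> space M)
        = (\<Inter>i\<in>J. X i -` A i \<inter> space M) \<inter> (\<Inter>i\<in>J. Y i -` B i \<inter> space M)"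
      using J(1) unfolding P_def by auto
    also have "\<dots> = ((\<lambda>\<omega>. \<lambda>i\<in>I. X i \<omega>) -` ?A \<inter> space M)
        \<inter> ((\<lambda>\<omega>. \<lambda>i\<in>I. Y i \<omega>) -` ?B \<inter> space M)"
      by (simp only: emb[of X S A, OF rvX] emb[of Y T B, OF rvY])
    also have "\<dots> = (\<lambda>\<omega>. (\<lambda>i\<in>I. X i \<omega>, \<lambda>i\<in>I. Y i \<omega>)) -` (?A \<times> ?B) \<inter> space M"
      by auto
    also have "prob \<dots> = prob ((\<lambda>\<omega>. \<lambda>i\<in>I. X i \<omega>) -` ?A \<inter> space M)
        * prob ((\<lambda>\<omega>. \<lambda>i\<in>I. Y i \<omega>) -` ?B \<inter> space M)"
      using J AB by (intro indep_varD[OF XY] sets_PiM_I) auto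
    also have "\<dots> = prob (\<Inter>i\<in>J. X i -` A i \<inter> space M) * prob (\<Inter>i\<in>J. Y i -` B i \<inter> space M)"
      by (simp only: emb[of X S A, OF rvX] emb[of Y T B, OF rvY])
    also have "\<dots> = (\<Prod>i\<in>J. prob (X i -` A i \<inter> space M)) * (\<Prod>i\<in>J. prob (Y i -` B i \<inter> space M))"
      using indep_varsD[OF X, of J A] indep_varsD[OF Y, of J B] J AB by simp
    finally show ?thesis .
  qed
  have "indep_sets R I"
  proof (rule indep_setsI)
    fix i assume "i \<in> I"
    then show "R i \<subseteq> events"
      unfolding R_def using rvP by (auto intro!: measurable_sets[of "P i" M "S i \<Otimes>\<^sub>M T i"])
  next
    fix C J assume J: "J \<noteq> {}" "J \<subseteq> I" "finite J" and C: "\<forall>j\<in>J. C j \<in> R j"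
    have "\<forall>j\<in>J. \<exists>a b. C j = P j -` (a \<times> b) \<inter> space M \<and> a \<in> sets (S j) \<and> b \<in> sets (T j)"
      using C unfolding R_def by blast
    then obtain A B where AB: "\<And>j. j \<in> J \<Longrightarrow> C j = P j -` (A j \<times> B j) \<inter> space M"
      "\<And>j. j \<in> J \<Longrightarrow> A j \<in> sets (S j)" "\<And>j. j \<in> J \<Longrightarrow> B j \<in> sets (T j)"
      by metis
    \<comment> \<open>The one-index case of \<open>split\<close> supplies the individual factors,
      which are then matched with the case of all of \<open>J\<close>.\<close>
    have "prob (C j) = prob (X j -` A j \<inter> space M) * prob (Y j -` B j \<inter> space M)" if "j \<in> J" for j
      using split[of "{j}" A B] that AB J by auto
    moreover have "prob (\<Inter>j\<in>J. C j) =
        (\<Prod>i\<in>J. prob (X i -` A i \<inter> space M)) * (\<Prod>i\<in>J. prob (Y i -` B i \<inter> space M))"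
      using split[of J A B] J AB by simp
    ultimately show "prob (\<Inter>j\<in>J. C j) = (\<Prod>j\<in>J. prob (C j))"
      by (simp add: prod.distrib)
  qed
  moreover have "Int_stable (R i)" for i
  proof (rule Int_stableI)
    fix c d assume "c \<in> R i" "d \<in> R i"
    then obtain a b a' b' where
      "c = P i -` (a \<times> b) \<inter> space M" "a \<in> sets (S i)" "b \<in> sets (T i)"
      "d = P i -` (a' \<times> b') \<inter> space M" "a' \<in> sets (S i)" "b' \<in> sets (T i)"
      unfolding R_def by blast
    then show "c \<inter> d \<in> R i"
      unfolding R_def by (intro CollectI exI[of _ "(a \<inter> a') \<times> (b \<inter> b')"]) auto
  qed
  ultimately have "indep_sets (\<lambda>i. sigma_sets (space M) (R i)) I"
    by (intro indep_sets_sigma)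
  moreover have "{P i -` C \<inter> space M | C. C \<in> sets (S i \<Otimes>\<^sub>M T i)} = sigma_sets (space M) (R i)"
    if "i \<in> I" for i
    unfolding R_def sets_pair_measure
    using measurable_space[OF rvP[OF that]]
    by (intro sigma_sets_vimage_commute) (auto simp: space_pair_measure)
  ultimately have "indep_vars (\<lambda>i. S i \<Otimes>\<^sub>M T i) P I"
    unfolding indep_vars_def2 using rvP by (simp cong: indep_sets_cong)
  then show ?thesis by (simp add: P_def)
qed

section \<open>Weak laws of large numbers\<close>

text \<open>Hoeffding's inequality for summands in [0,1] bounds the probability by a geometric
  sequence of ratio \<open>exp (- 2 * c\<^sup>2) < 1\<close>.\<close>

lemma (in prob_space) weak_law_bounded:
  fixes Y :: "nat \<Rightarrow> 'a \<Rightarrow> real"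
  assumes ind: "indep_vars (\<lambda>_. borel) Y {1..}"
    and bd: "\<And>i \<omega>. 0 \<le> Y i \<omega> \<and> Y i \<omega> \<le> 1"
    and mean: "\<And>i. i \<ge> 1 \<Longrightarrow> expectation (Y i) = q"
    and c: "c > 0"
  shows "(\<lambda>k. prob {\<omega> \<in> space M. \<bar>(\<Sum>i=1..k. Y i \<omega>) - real k * q\<bar> \<ge> c * real k}) \<longlonglongrightarrow> 0"
proof (rule tendsto_sandwich[where f="\<lambda>_. 0"])
  show "\<forall>\<^sub>F k in sequentially. prob {\<omega> \<in> space M. \<bar>(\<Sum>i=1..k. Y i \<omega>) - real k * q\<bar> \<ge> c * real k}
      \<le> 2 * exp (- 2 * c\<^sup>2) ^ k"
    \<comment> \<open>Hoeffding's exponent has the sum of squared ranges, here \<open>k\<close>, as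
      denominator, so \<open>k = 0\<close> is excluded.\<close>
    using eventually_gt_at_top[of 0]
  proof eventually_elim
    case (elim k)
    interpret Hoeffding_ineq M "{1..k}" Y "\<lambda>_. 0" "\<lambda>_. 1" "\<Sum>i=1..k. expectation (Y i)"
      by unfold_locales (use bd in \<open>auto intro: indep_vars_subset[OF ind]\<close>)
    have "(\<Sum>i=1..k. expectation (Y i)) = real k * q"
      using mean by simp
    moreover have "- 2 * (c * real k)\<^sup>2 / real k = real k * (- 2 * c\<^sup>2)"
      using elim by (simp add: power2_eq_square)
    moreover have "exp (- 2 * c\<^sup>2) ^ k = exp (real k * (- 2 * c\<^sup>2))"
      by (simp only: exp_of_nat_mult)
    ultimately show ?case
      using Hoeffding_ineq_abs_ge[of "c * real k"] c elim by simp
  qed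
  show "(\<lambda>k. 2 * exp (- 2 * c\<^sup>2) ^ k) \<longlonglongrightarrow> 0"
    using c by (intro tendsto_mult_right_zero LIMSEQ_power_zero) auto
qed auto

text \<open>The form needed for counts: \<open>Z\<close> may take values in any measurable space, so
  that \<open>Q\<close> can be a condition on a pair.\<close>

lemma (in prob_space) weak_law_indicator:
  assumes ind: "indep_vars (\<lambda>_. S) Z {1..}"
    and Q: "{z \<in> space S. Q z} \<in> sets S"
    and mean: "\<And>i. i \<ge> 1 \<Longrightarrow> prob {\<omega> \<in> space M. Q (Z i \<omega>)} = q"
    and c: "c > 0"
  shows "(\<lambda>k. prob {\<omega> \<in> space M.
    \<bar>(\<Sum>i=1..k. of_bool (Q (Z i \<omega>))) - real k * q\<bar> \<ge> c * real k}) \<longlonglongrightarrow> 0"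
proof (rule weak_law_bounded)
  have Qm: "Measurable.pred S Q"
    using Q by (simp add: pred_def)
  then have "(\<lambda>z. of_bool (Q z) :: real) \<in> borel_measurable S"
    by measurable
  then show "indep_vars (\<lambda>_. borel) (\<lambda>i \<omega>. of_bool (Q (Z i \<omega>)) :: real) {1..}"
    by (intro indep_vars_compose2[OF ind]) auto
  fix i :: nat assume i: "i \<ge> 1"
  have [measurable]: "Z i \<in> measurable M S"
    using ind i by (auto simp: indep_vars_def)
  have ev: "{\<omega> \<in> space M. Q (Z i \<omega>)} \<in> events"
    using Qm by measurable
  have "expectation (\<lambda>\<omega>. of_bool (Q (Z i \<omega>)))
      = expectation (indicator {\<omega> \<in> space M. Q (Z i \<omega>)} :: _ \<Rightarrow> real)"
    by (intro Bochner_Integration.integral_cong) auto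
  also have "\<dots> = q"
    using ev mean[OF i] by simp
  finally show "expectation (\<lambda>\<omega>. of_bool (Q (Z i \<omega>))) = q" .
qed (use c in auto)

section \<open>Comparison of two independent positive variables\<close>

text \<open>Otherwise each event \<open>X \<omega> > 1/(n+1)\<close> is null, hence so is their
  countable union, which is the event that \<open>X\<close> is positive.\<close>

lemma (in prob_space) AE_pos_imp_prob_gt:
  fixes X :: "'a \<Rightarrow> real"
  assumes [measurable]: "X \<in> borel_measurable M" and pos: "AE \<omega> in M. X \<omega> > 0"
  obtains x where "x > 0" "prob {\<omega> \<in> space M. X \<omega> > x} > 0"
proof (rule ccontr)
  assume "\<not> thesis"
  then have "\<not> prob {\<omega> \<in> space M. X \<omega> > inverse (real (Suc n))} > 0" for n
    using that[of "inverse (real (Suc n))"] by auto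
  then have "prob {\<omega> \<in> space M. X \<omega> > inverse (real (Suc n))} = 0" for n
    by (simp add: zero_less_measure_iff)
  then have "AE \<omega> in M. \<not> X \<omega> > inverse (real (Suc n))" for n
    by (subst AE_iff_measurable[OF _ refl]) (auto simp: emeasure_eq_measure)
  then have "AE \<omega> in M. \<forall>n. \<not> X \<omega> > inverse (real (Suc n))"
    by (simp add: AE_all_countable)
  with pos have "AE \<omega> in M. False"
    by eventually_elim (metis reals_Archimedean)
  then show False by simp
qed

lemma (in prob_space) indep_set_commute: "indep_set A B \<Longrightarrow> indep_set B A"
  by (intro indep_setI)
    (auto dest: indep_setD indep_setD_ev1 indep_setD_ev2 simp: Int_commute mult.commute)

lemma (in prob_space) indep_var_commute: "indep_var S X T Y \<Longrightarrow> indep_var T Y S X"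
  unfolding indep_var_eq using indep_set_commute by blast

text \<open>Pick a level \<open>x\<close> that \<open>Y\<close> exceeds with positive probability;
  the independent events \<open>X < x\<close> and \<open>Y > x\<close> together force
  \<open>X < Y\<close>. Applied in both orders of \<open>V\<close> and \<open>E\<close>, this yields
  both bounds on \<open>p\<close>.\<close>

lemma (in prob_space) indep_var_prob_less_pos:
  fixes X Y :: "'a \<Rightarrow> real"
  assumes ind: "indep_var borel X borel Y" and pos: "AE \<omega> in M. Y \<omega> > 0"
    and small: "\<And>x. x > 0 \<Longrightarrow> prob {\<omega> \<in> space M. X \<omega> < x} > 0"
  shows "prob {\<omega> \<in> space M. X \<omega> < Y \<omega>} > 0"
proof -
  have [measurable]: "X \<in> borel_measurable M" "Y \<in> borel_measurable M"
    using ind indep_var_rv1 indep_var_rv2 by blast+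
  obtain x where x: "x > 0" "prob {\<omega> \<in> space M. Y \<omega> > x} > 0"
    using AE_pos_imp_prob_gt[OF _ pos] by auto
  have "0 < prob {\<omega> \<in> space M. X \<omega> < x} * prob {\<omega> \<in> space M. Y \<omega> > x}"
    using x small by simp
  also have "\<dots> = prob {\<omega> \<in> space M. X \<omega> < x \<and> Y \<omega> > x}"
    using prob_indep_random_variable[OF ind, of "{..<x}" "{x<..}"] by simp
  also have "\<dots> \<le> prob {\<omega> \<in> space M. X \<omega> < Y \<omega>}"
    by (intro finite_measure_mono) auto
  finally show ?thesis .
qed

theorem theorem2p9:
  fixes N :: "'a measure" and V E :: "'a \<Rightarrow> real"
    and M :: "'b measure" and Vs Es :: "nat \<Rightarrow> 'b \<Rightarrow> real"
    and p :: real
  assumes "prob_space N"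
    and "continuous_rv N V" and "continuous_rv N E"
    and "AE \<omega> in N. V \<omega> > 0" and "AE \<omega> in N. E \<omega> > 0"
    and "prob_space.indep_var N borel V borel E"
    and "\<And>x. x > 0 \<Longrightarrow> measure N {\<omega> \<in> space N. V \<omega> < x} > 0"
    and "\<And>x. x > 0 \<Longrightarrow> measure N {\<omega> \<in> space N. E \<omega> < x} > 0"
    and "prob_space M"
    and "iid_copies M Vs N V" and "iid_copies M Es N E"
    and "indep_seqs M Vs Es"
    and "p = measure N {\<omega> \<in> space N. V \<omega> > E \<omega>}"
  shows "0 < p \<and> p < 1 \<and>
    (\<exists>R \<in> little_o_P M. \<forall>k\<ge>1. \<forall>\<omega> \<in> space M.
       D_hat Vs Es k \<omega> = p * real k * (1 + R k \<omega>))"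
proof -

  \<comment> \<open>Joint law of a pair of copies\<close>
  interpret N: prob_space N by fact
  interpret M: prob_space M by fact
  have [measurable]: "V \<in> borel_measurable N" "E \<in> borel_measurable N"
    using assms(2,3) by (auto simp: continuous_rv_def)
  define L where "L = (borel :: real measure) \<Otimes>\<^sub>M (borel :: real measure)"
  define Z where "Z = (\<lambda>i \<omega>. (Vs i \<omega>, Es i \<omega>))"
  have VE: "N.indep_var borel V borel E" by fact
  have indV: "M.indep_vars (\<lambda>_. borel) Vs {1..}" and indE: "M.indep_vars (\<lambda>_. borel) Es {1..}"
    using assms(10,11) by (auto simp: iid_copies_def)
  have indVE: "M.indep_var (PiM {1..} (\<lambda>_. borel)) (\<lambda>\<omega>. \<lambda>i\<in>{1..}. Vs i \<omega>)
      (PiM {1..} (\<lambda>_. borel)) (\<lambda>\<omega>. \<lambda>i\<in>{1..}. Es i \<omega>)"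
    using assms(12) by (simp add: indep_seqs_def)
  have indZ: "M.indep_vars (\<lambda>_. L) Z {1..}"
    unfolding L_def Z_def by (rule M.indep_vars_Pair[OF indV indE indVE])
  have rv: "Vs i \<in> borel_measurable M" "Es i \<in> borel_measurable M" if "i \<ge> 1" for i
    using indV indE that by (auto simp: M.indep_vars_def)

  \<comment> \<open>Moves probabilities from \<open>M\<close> to \<open>N\<close>: by independence
    both joint laws are products of their marginals, and the marginals agree since the sequences
    consist of copies.\<close>
  have law: "M.prob {\<omega> \<in> space M. \<phi> (Z i \<omega>)} = N.prob {\<omega> \<in> space N. \<phi> (V \<omega>, E \<omega>)}"
    if i: "i \<ge> 1" and \<phi>: "Measurable.pred L \<phi>" for i \<phi>
  proof -
    have [measurable]: "Vs i \<in> borel_measurable M" "Es i \<in> borel_measurable M"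
      using rv[OF i] .
    \<comment> \<open>Evaluating both sequences at coordinate \<open>i\<close> reduces independence
      of the sequences to that of \<open>Vs i\<close> and \<open>Es i\<close>.\<close>
    have "M.indep_var borel ((\<lambda>f. f i) \<circ> (\<lambda>\<omega>. \<lambda>i\<in>{1..}. Vs i \<omega>))
        borel ((\<lambda>f. f i) \<circ> (\<lambda>\<omega>. \<lambda>i\<in>{1..}. Es i \<omega>))"
      using i by (intro M.indep_var_compose[OF indVE] measurable_component_singleton) auto
    also have "(\<lambda>f. f i) \<circ> (\<lambda>\<omega>. \<lambda>i\<in>{1..}. Vs i \<omega>) = Vs i"
      using i by auto
    also have "(\<lambda>f. f i) \<circ> (\<lambda>\<omega>. \<lambda>i\<in>{1..}. Es i \<omega>) = Es i"
      using i by auto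
    finally have "distr M L (Z i) = distr M borel (Vs i) \<Otimes>\<^sub>M distr M borel (Es i)"
      unfolding L_def Z_def using M.indep_var_distribution_eq by metis
    also have "\<dots> = distr N borel V \<Otimes>\<^sub>M distr N borel E"
      using assms(10,11) i by (simp add: iid_copies_def)
    also have "\<dots> = distr N L (\<lambda>\<omega>. (V \<omega>, E \<omega>))"
      unfolding L_def using VE N.indep_var_distribution_eq by metis
    finally have eq: "distr M L (Z i) = distr N L (\<lambda>\<omega>. (V \<omega>, E \<omega>))" .
    have Zm: "Z i \<in> measurable M L" and VEm: "(\<lambda>\<omega>. (V \<omega>, E \<omega>)) \<in> measurable N L"
      unfolding Z_def L_def by measurable
    have A: "{z \<in> space L. \<phi> z} \<in> sets L"
      using \<phi> by (simp add: pred_def)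
    have "M.prob {\<omega> \<in> space M. \<phi> (Z i \<omega>)} = measure (distr M L (Z i)) {z \<in> space L. \<phi> z}"
      using measure_distr[OF Zm A] measurable_space[OF Zm]
      by (auto intro!: arg_cong[where f="M.prob"])
    also have "\<dots> = N.prob {\<omega> \<in> space N. \<phi> (V \<omega>, E \<omega>)}"
      unfolding eq using measure_distr[OF VEm A] measurable_space[OF VEm]
      by (auto intro!: arg_cong[where f="N.prob"])
    finally show ?thesis .
  qed

  \<comment> \<open>Bounds on \<open>p\<close>\<close>
  have p0: "0 < p"
    unfolding assms(13) using N.indep_var_prob_less_pos[of E V] assms(4,8)
      N.indep_var_commute[OF VE] by auto
  \<comment> \<open>The event \<open>V < E\<close> is disjoint from the one defining
    \<open>p\<close>, so its positive probability keeps \<open>p\<close> below 1.\<close>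
  have "0 < N.prob {\<omega> \<in> space N. V \<omega> < E \<omega>}"
    using N.indep_var_prob_less_pos[OF VE] assms(5,7) by auto
  moreover have "p + N.prob {\<omega> \<in> space N. V \<omega> < E \<omega>} \<le> 1"
    unfolding assms(13)
    by (subst N.finite_measure_Union[symmetric]) auto
  ultimately have p1: "p < 1" by simp

  \<comment> \<open>Measurability\<close>
  have rvZ: "(\<lambda>\<omega>. Vs i \<omega> + Es i \<omega>) \<in> borel_measurable M"
    "(\<lambda>\<omega>. Vs i \<omega> - Es i \<omega>) \<in> borel_measurable M" if "i \<ge> 1" for i
    using rv[OF that] by measurable
  have xi_m: "xi Vs Es k \<in> borel_measurable M" if "k \<ge> 1" for k
    unfolding xi_def[abs_def] using rvZ that by (intro borel_measurable_Min) auto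
  have D_m [measurable]: "D_hat Vs Es k \<in> borel_measurable M" for k
  \<comment> \<open>For \<open>k = 0\<close> the minimum in \<open>xi\<close> is over the empty set,
    but the sum is empty too and \<open>D_hat\<close> is the constant 1.\<close>
  proof (cases "k \<ge> 1")
    case True
    then have "Measurable.pred M (\<lambda>\<omega>. xi Vs Es k \<omega> < Vs i \<omega> - Es i \<omega>)" if "i \<in> {1..k}" for i
      using xi_m rvZ that by (intro borel_measurable_pred_less) auto
    then show ?thesis
      unfolding D_hat_def[abs_def]
      by (intro borel_measurable_add borel_measurable_const borel_measurable_sum)
        (auto intro: measurable_compose[OF _ measurable_of_bool])
  qed (simp add: D_hat_def[abs_def])

  \<comment> \<open>Convergence of the minimum to 0\<close>
  have xi_small: "(\<lambda>k. M.prob {\<omega> \<in> space M. xi Vs Es k \<omega> > t}) \<longlonglongrightarrow> 0" if t: "t > 0" for t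
  proof -
    define r where "r = N.prob {\<omega> \<in> space N. V \<omega> + E \<omega> > t}"
    \<comment> \<open>Shows \<open>r < 1\<close>: both variables lie below \<open>t/2\<close> with
      positive probability, and this event is disjoint from \<open>V + E > t\<close>.\<close>
    have "0 < N.prob {\<omega> \<in> space N. V \<omega> < t/2} * N.prob {\<omega> \<in> space N. E \<omega> < t/2}"
      using t assms(7,8)[of "t/2"] by (intro mult_pos_pos) auto
    also have "\<dots> = N.prob {\<omega> \<in> space N. V \<omega> < t/2 \<and> E \<omega> < t/2}"
      using N.prob_indep_random_variable[OF VE, of "{..<t/2}" "{..<t/2}"] by simp
    finally have "r < r + N.prob {\<omega> \<in> space N. V \<omega> < t/2 \<and> E \<omega> < t/2}"
      by simp
    also have "\<dots> \<le> 1"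
      unfolding r_def by (subst N.finite_measure_Union[symmetric]) auto
    finally have "r < 1" .
    moreover have "0 \<le> r" by (simp add: r_def)
    ultimately have lim: "(\<lambda>k. r ^ k) \<longlonglongrightarrow> 0"
      by (intro LIMSEQ_power_zero) auto
    have A: "{z \<in> space L. fst z + snd z > t} \<in> sets L"
      unfolding L_def by measurable
    \<comment> \<open>The minimum exceeds \<open>t\<close> exactly when all \<open>k\<close> sums
      do, and these are independent with the law of \<open>V + E\<close>.\<close>
    have "M.prob {\<omega> \<in> space M. xi Vs Es k \<omega> > t} = r ^ k" if k: "k \<ge> 1" for k
    proof -
      have Zs: "Z i -` {z \<in> space L. fst z + snd z > t} \<inter> space M
          = {\<omega> \<in> space M. Vs i \<omega> + Es i \<omega> > t}" for i
        by (auto simp: Z_def L_def space_pair_measure)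
      have "{\<omega> \<in> space M. xi Vs Es k \<omega> > t}
          = (\<Inter>i\<in>{1..k}. Z i -` {z \<in> space L. fst z + snd z > t} \<inter> space M)"
        unfolding Zs using k by (auto simp: xi_def Min_gr_iff)
      also have "M.prob \<dots> = (\<Prod>i\<in>{1..k}. M.prob (Z i -` {z \<in> space L. fst z + snd z > t} \<inter> space M))"
        using k A by (intro M.indep_varsD[OF indZ]) auto
      also have "\<dots> = (\<Prod>i\<in>{1..k}. r)"
        unfolding Zs r_def
        using law[of _ "\<lambda>z. fst z + snd z > t"] A
        by (intro prod.cong) (auto simp: Z_def pred_def)
      finally show ?thesis by simp
    qed
    then have "eventually (\<lambda>k. r ^ k = M.prob {\<omega> \<in> space M. xi Vs Es k \<omega> > t}) sequentially"
      by (intro eventually_mono[OF eventually_ge_at_top[of 1]]) simp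
    then show ?thesis by (rule Lim_transform_eventually[OF lim])
  qed

  \<comment> \<open>Tail of \<open>V - E\<close> and counts at a fixed level\<close>
  define q where "q t = N.prob {\<omega> \<in> space N. V \<omega> - E \<omega> > t}" for t
  have q0: "q 0 = p" by (simp add: q_def assms(13))
  \<comment> \<open>Continuity from below: as the level decreases to 0, the events increase to
    \<open>V > E\<close>.\<close>
  have q_lim: "(\<lambda>n. q (inverse (real (Suc n)))) \<longlonglongrightarrow> p"
  proof -
    define A where "A n = {\<omega> \<in> space N. V \<omega> - E \<omega> > inverse (real (Suc n))}" for n
    have "(\<lambda>n. N.prob (A n)) \<longlonglongrightarrow> N.prob (\<Union>n. A n)"
    proof (rule N.finite_Lim_measure_incseq)
      show "range A \<subseteq> N.events" unfolding A_def by auto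
      have "inverse (real (Suc (Suc n))) \<le> inverse (real (Suc n))" for n
        by (intro le_imp_inverse_le) auto
      then show "incseq A" unfolding A_def by (intro incseq_SucI) (blast intro: le_less_trans)
    qed
    moreover have "(\<Union>n. A n) = {\<omega> \<in> space N. V \<omega> > E \<omega>}"
    proof (intro equalityI subsetI)
      fix \<omega> assume "\<omega> \<in> (\<Union>n. A n)"
      then obtain n where "\<omega> \<in> space N" "inverse (real (Suc n)) < V \<omega> - E \<omega>"
        by (auto simp: A_def)
      then have "0 < V \<omega> - E \<omega>"
        by (smt (verit) inverse_positive_iff_positive of_nat_0_less_iff zero_less_Suc)
      with \<open>\<omega> \<in> space N\<close> show "\<omega> \<in> {\<omega> \<in> space N. V \<omega> > E \<omega>}" by auto
    next
      fix \<omega> assume "\<omega> \<in> {\<omega> \<in> space N. V \<omega> > E \<omega>}"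
      then show "\<omega> \<in> (\<Union>n. A n)"
        using reals_Archimedean[of "V \<omega> - E \<omega>"] by (auto simp: A_def simp del: of_nat_Suc)
    qed
    ultimately show ?thesis by (simp add: A_def q_def assms(13))
  qed

  \<comment> \<open>The indicators in \<open>D_hat\<close> all depend on the common random level
    \<open>xi\<close>; a deterministic level \<open>t\<close> makes them independent.\<close>
  define S where "S t k \<omega> = (\<Sum>i=1..k. of_bool (Vs i \<omega> - Es i \<omega> > t) :: real)" for t k \<omega>
  have [measurable]: "S t k \<in> borel_measurable M" for t k
    unfolding S_def[abs_def] using rvZ
    by (intro borel_measurable_sum measurable_compose[OF _ measurable_of_bool]
        borel_measurable_pred_less) auto
  have S_lim: "(\<lambda>k. M.prob {\<omega> \<in> space M. \<bar>S t k \<omega> - real k * q t\<bar> \<ge> c * real k}) \<longlonglongrightarrow> 0"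
    if "c > 0" for c t
  proof -
    have A: "{z \<in> space L. fst z - snd z > t} \<in> sets L"
      unfolding L_def by measurable
    have "M.prob {\<omega> \<in> space M. fst (Z i \<omega>) - snd (Z i \<omega>) > t} = q t" if "i \<ge> 1" for i
      using law[OF that, of "\<lambda>z. fst z - snd z > t"] A by (simp add: pred_def q_def)
    from M.weak_law_indicator[OF indZ A this \<open>c > 0\<close>] show ?thesis
      by (simp add: S_def Z_def)
  qed

  \<comment> \<open>Positivity passes to each copy through \<open>law\<close>; a countable
    intersection gives one null set valid for all \<open>k\<close>.\<close>
  have xi_nonneg: "AE \<omega> in M. \<forall>k\<ge>1. xi Vs Es k \<omega> \<ge> 0"
  proof -
    have "AE \<omega> in M. i \<ge> 1 \<longrightarrow> Vs i \<omega> > 0 \<and> Es i \<omega> > 0" for i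
    proof (cases "i \<ge> 1")
      case True
      have "Measurable.pred L (\<lambda>z. fst z > 0 \<and> snd z > 0)"
        unfolding L_def by measurable
      moreover have "N.prob {\<omega> \<in> space N. V \<omega> > 0 \<and> E \<omega> > 0} = 1"
        using assms(4,5) by (subst N.prob_Collect_eq_1) auto
      ultimately have "M.prob {\<omega> \<in> space M. Vs i \<omega> > 0 \<and> Es i \<omega> > 0} = 1"
        using law[OF True, of "\<lambda>z. fst z > 0 \<and> snd z > 0"] by (simp add: Z_def)
      then show ?thesis
        using rv[OF True] by (subst (asm) M.prob_Collect_eq_1) auto
    qed auto
    then have "AE \<omega> in M. \<forall>i\<ge>1. Vs i \<omega> > 0 \<and> Es i \<omega> > 0"
      by (simp add: AE_all_countable)
    then show ?thesis
    proof eventually_elim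
      case (elim \<omega>)
      then show ?case
        by (auto simp: xi_def Min_ge_iff intro: add_nonneg_nonneg less_imp_le)
    qed
  qed

  \<comment> \<open>The relative error tends to 0 in probability\<close>
  \<comment> \<open>Obtained by solving the claimed identity for the error. Division by zero makes
    \<open>R 0\<close> equal to -1, which is harmless because the identity is asked only for
    \<open>k \<ge> 1\<close>.\<close>
  define R where "R k \<omega> = D_hat Vs Es k \<omega> / (p * real k) - 1" for k \<omega>
  have R_m [measurable]: "R k \<in> borel_measurable M" for k
    unfolding R_def[abs_def] by measurable
  have "(\<lambda>k. M.prob {\<omega> \<in> space M. \<bar>R k \<omega>\<bar> > \<epsilon>}) \<longlonglongrightarrow> 0" if \<epsilon>: "\<epsilon> > 0" for \<epsilon>
  proof -
    \<comment> \<open>Off the bad events \<open>D_hat\<close> differs from \<open>p * k\<close> by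
      at most \<open>2 * c * k\<close>: above, from the leading 1 and the fluctuation of
      \<open>S 0 k\<close>; below, from the gap \<open>p - q t\<close> and the fluctuation of
      \<open>S t k\<close>. The divisor 4 leaves room to spare.\<close>
    define c where "c = p * \<epsilon> / 4"
    have c: "c > 0" using p0 \<epsilon> by (simp add: c_def)
    have "eventually (\<lambda>n. q (inverse (real (Suc n))) > p - c) sequentially"
      using q_lim c by (intro order_tendstoD(1)) auto
    then obtain n where n: "q (inverse (real (Suc n))) > p - c"
      by (meson eventually_happens sequentially_bot)
    define t where "t = inverse (real (Suc n))"
    have t: "t > 0" "q t > p - c" using n by (auto simp: t_def)
    let ?A = "\<lambda>k. {\<omega> \<in> space M. xi Vs Es k \<omega> > t}"
    let ?B = "\<lambda>t k. {\<omega> \<in> space M. \<bar>S t k \<omega> - real k * q t\<bar> \<ge> c * real k}"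
    have bound: "M.prob {\<omega> \<in> space M. \<bar>R k \<omega>\<bar> > \<epsilon>}
        \<le> M.prob (?A k) + (M.prob (?B 0 k) + M.prob (?B t k))"
      if k: "k \<ge> 1" "1 \<le> c * real k" for k
    proof -
      have [measurable]: "xi Vs Es k \<in> borel_measurable M" using xi_m k by simp
      \<comment> \<open>The inclusion holds only almost everywhere, since the upper bound by
        \<open>S 0 k\<close> relies on \<open>xi\<close> being nonnegative.\<close>
      have "AE \<omega> in M. \<omega> \<in> {\<omega> \<in> space M. \<bar>R k \<omega>\<bar> > \<epsilon>} \<longrightarrow> \<omega> \<in> ?A k \<union> (?B 0 k \<union> ?B t k)"
        using xi_nonneg
      proof eventually_elim
        case (elim \<omega>)
        have "\<not> \<bar>R k \<omega>\<bar> > \<epsilon>" if \<omega>: "\<not> xi Vs Es k \<omega> > t"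
          "\<not> \<bar>S 0 k \<omega> - real k * q 0\<bar> \<ge> c * real k" "\<not> \<bar>S t k \<omega> - real k * q t\<bar> \<ge> c * real k"
        proof -
          have "0 \<le> xi Vs Es k \<omega>" using elim k by blast
          then have "D_hat Vs Es k \<omega> \<le> 1 + S 0 k \<omega>"
            unfolding D_hat_def S_def by (intro add_left_mono sum_mono) auto
          moreover have "1 + S t k \<omega> \<le> D_hat Vs Es k \<omega>"
            unfolding D_hat_def S_def using \<omega>(1) by (intro add_left_mono sum_mono) auto
          moreover have "real k * p - real k * c \<le> real k * q t"
            using t(2) by (simp flip: right_diff_distrib add: mult_left_mono)
          ultimately have "\<bar>D_hat Vs Es k \<omega> - p * real k\<bar> \<le> 4 * (c * real k)"
            using \<omega>(2,3) k(2) q0 by (auto simp: mult.commute abs_le_iff not_le abs_less_iff)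
          also have "\<dots> = \<epsilon> * (p * real k)" by (simp add: c_def)
          finally have "\<bar>D_hat Vs Es k \<omega> - p * real k\<bar> / (p * real k) \<le> \<epsilon>"
            using p0 k by (simp add: pos_divide_le_eq)
          moreover have "R k \<omega> = (D_hat Vs Es k \<omega> - p * real k) / (p * real k)"
            using p0 k by (simp add: R_def diff_divide_distrib)
          ultimately show ?thesis using p0 k by (simp add: abs_mult)
        qed
        then show ?case by blast
      qed
      then have "M.prob {\<omega> \<in> space M. \<bar>R k \<omega>\<bar> > \<epsilon>} \<le> M.prob (?A k \<union> (?B 0 k \<union> ?B t k))"
        by (intro M.finite_measure_mono_AE) auto
      also have "\<dots> \<le> M.prob (?A k) + M.prob (?B 0 k \<union> ?B t k)"
        by (intro measure_Un_le) auto
      also have "M.prob (?B 0 k \<union> ?B t k) \<le> M.prob (?B 0 k) + M.prob (?B t k)"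
        by (intro measure_Un_le) auto
      finally show ?thesis by simp
    qed
    \<comment> \<open>From such \<open>k\<close> on, the leading 1 of \<open>D_hat\<close> is
      absorbed into \<open>c * k\<close>.\<close>
    have "eventually (\<lambda>k. k \<ge> 1 \<and> 1 \<le> c * real k) sequentially"
    proof -
      have "eventually (\<lambda>k. k \<ge> max 1 (nat \<lceil>1 / c\<rceil>)) sequentially"
        by (rule eventually_ge_at_top)
      then show ?thesis
      proof eventually_elim
        case (elim k)
        then have "1 / c \<le> real k" by linarith
        then show ?case using c elim by (simp add: pos_divide_le_eq mult.commute)
      qed
    qed
    then have ev: "eventually (\<lambda>k. M.prob {\<omega> \<in> space M. \<bar>R k \<omega>\<bar> > \<epsilon>}
        \<le> M.prob (?A k) + (M.prob (?B 0 k) + M.prob (?B t k))) sequentially"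
      by eventually_elim (use bound in blast)
    have "(\<lambda>k. M.prob (?A k) + (M.prob (?B 0 k) + M.prob (?B t k))) \<longlonglongrightarrow> 0"
      using tendsto_add[OF xi_small[OF t(1)] tendsto_add[OF S_lim[OF c] S_lim[OF c]]] by simp
    then show ?thesis
      by (rule tendsto_sandwich[OF _ ev tendsto_const, rotated]) simp
  qed
  then have "R \<in> little_o_P M"
    by (simp add: little_o_P_def)
  moreover have "\<forall>k\<ge>1. \<forall>\<omega>\<in>space M. D_hat Vs Es k \<omega> = p * real k * (1 + R k \<omega>)"
    using p0 by (simp add: R_def)
  ultimately show ?thesis
    using p0 p1 by blast
qed

end
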